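(* Let $n\geq 1$, let $T>0$ and $\beta:=1/T$, let $V\in\mathbb{R}\cup\{+\infty\}$ be a monomer energy, and let $W:\mathbb{Z}^n\to\mathbb{R}\cup\{+\infty\}$ be a symmetric function (that is, $W(-z)=W(z)$ for all $z$) with $W(0)\neq+\infty$ such that $\sum_{z\in\mathbb{Z}^n\setminus\{0\}}\mathrm{e}^{-\beta W(z)}<+\infty$ and $$\mathrm{e}^{-\beta W(0)}\geq \sum_{z\in\mathbb{Z}^n\setminus\{0\}}\mathrm{e}^{-\beta W(z)}.$$ Let $\xi=(\xi_x)_{x\in\mathbb{Z}^n}$ be the auxiliary Gaussian random field, i.e. a real-valued homogeneous Gaussian random field on $\mathbb{Z}^n$ with $$\mathbf{E}\,\xi_x=\mathrm{e}^{-\beta V},\qquad \mathbf{cov}(\xi_x,\xi_y)=\mathrm{e}^{-\beta W(x-y)}\qquad\text{for all } x,y\in\mathbb{Z}^n .$$ Then for any nonempty finite set $\Lambda\subset\mathbb{Z}^n$, the partition function $Z_\Lambda$ of the elastic dimer-monomer system on $\Lambda$ with monomer energy $V$ and dimer potential $W$ coincides with the product moment of $\xi$ over $\Lambda$: $$Z_\Lambda=\mathbf{E}\prod_{x\in\Lambda}\xi_x .$$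
   Context: Elastic dimer-monomer (EDM) system. For a nonempty finite set $\Lambda\subset\mathbb{Z}^n$ with $N:=\#\Lambda$ sites, a configuration $\omega$ is a partition of $\Lambda$ into two-element subsets (dimers) and singletons (monomers). Equivalently, $\omega$ consists of a subset $D\subset\Lambda$ of even cardinality $2r$ together with a partition $\{\{x_1,y_1\},\ldots,\{x_r,y_r\}\}$ of $D$ into two-element subsets; the sites of $\Lambda\setminus D$ are occupied by monomers. The dimers may consist of arbitrarily distant sites. The set of all configurations is denoted by $\Omega_\Lambda$. The energy of the configuration $\omega$ is $$U(\omega):=(N-2r)V+\sum_{k=1}^r W(x_k-y_k),$$ and the (canonical) partition function is $Z_\Lambda:=\sum_{\omega\in\Omega_\Lambda}\mathrm{e}^{-\beta U(\omega)}$. Only the values of $W$ on $\mathbb{Z}^n\setminus\{0\}$ enter $Z_\Lambda$; the value $W(0)$ is an extension used to define the covariance function. Conventions: $\mathrm{e}^{-\beta\cdot(+\infty)}=0$ and $0\cdot(+\infty)=0$. The displayed inequality on $W$ guarantees that $z\mapsto \mathrm{e}^{-\beta W(z)}$ is positive definite, so that a Gaussian random field $\xi$ as described exists. A Gaussian random field is a family of random variables all of whose finite subfamilies are jointly Gaussian (possibly degenerate). *)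

theory Defs
  imports "HOL-Probability.Probability"
begin

(* exp (- beta e) for an energy e in (-oo, +oo], with exp (- beta (+oo)) = 0 *)
definition boltzmann :: "real \<Rightarrow> ereal \<Rightarrow> real" where
  "boltzmann \<beta> e = (if e = \<infinity> then 0 else exp (- \<beta> * real_of_ereal e))"

(* A configuration is the set of its blocks: two-element blocks are dimers, singletons are monomers. *)
definition configurations :: "'s set \<Rightarrow> 's set set set" where
  "configurations \<Lambda> = {\<omega>. partition_on \<Lambda> \<omega> \<and> (\<forall>B\<in>\<omega>. card B = 1 \<or> card B = 2)}"

definition dimers :: "'s set set \<Rightarrow> 's set set" where
  "dimers \<omega> = {B \<in> \<omega>. card B = 2}"

(* Well defined on two-element blocks only because the potential W is assumed to be even. *)
definition dimer_energy :: "('s::ab_group_add \<Rightarrow> ereal) \<Rightarrow> 's set \<Rightarrow> ereal" where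
  "dimer_energy W B = (THE e. \<exists>x y. B = {x, y} \<and> e = W (x - y))"

(* For configurations of \<Lambda> the natural-number subtraction is never truncated: it counts monomers.
   In ereal, 0 * (+oo) = 0. *)
definition config_energy ::
  "ereal \<Rightarrow> ('s::ab_group_add \<Rightarrow> ereal) \<Rightarrow> 's set \<Rightarrow> 's set set \<Rightarrow> ereal" where
  "config_energy V W \<Lambda> \<omega> =
     ereal (real (card \<Lambda> - 2 * card (dimers \<omega>))) * V + (\<Sum>B\<in>dimers \<omega>. dimer_energy W B)"

definition partition_function ::
  "real \<Rightarrow> ereal \<Rightarrow> ('s::ab_group_add \<Rightarrow> ereal) \<Rightarrow> 's set \<Rightarrow> real" where
  "partition_function \<beta> V W \<Lambda> =
     (\<Sum>\<omega>\<in>configurations \<Lambda>. boltzmann \<beta> (config_energy V W \<Lambda> \<omega>))"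

(* Univariate normal law; standard deviation 0 gives the degenerate (Dirac) case. *)
definition normal_law :: "real \<Rightarrow> real \<Rightarrow> real measure" where
  "normal_law \<mu> \<sigma> =
     (if \<sigma> = 0 then return borel \<mu> else density lborel (\<lambda>x. ennreal (normal_density \<mu> \<sigma> x)))"

definition gaussian_rv :: "'a measure \<Rightarrow> ('a \<Rightarrow> real) \<Rightarrow> bool" where
  "gaussian_rv M X \<longleftrightarrow>
     X \<in> borel_measurable M \<and> (\<exists>\<mu> \<sigma>. \<sigma> \<ge> 0 \<and> distr M borel X = normal_law \<mu> \<sigma>)"

(* Every linear combination is (possibly degenerate) normal; singular covariances are allowed. *)
definition jointly_gaussian :: "'a measure \<Rightarrow> 'i set \<Rightarrow> ('i \<Rightarrow> 'a \<Rightarrow> real) \<Rightarrow> bool" where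
  "jointly_gaussian M J X \<longleftrightarrow>
     (\<forall>c :: 'i \<Rightarrow> real. gaussian_rv M (\<lambda>\<omega>. \<Sum>i\<in>J. c i * X i \<omega>))"

definition gaussian_field :: "'a measure \<Rightarrow> ('i \<Rightarrow> 'a \<Rightarrow> real) \<Rightarrow> bool" where
  "gaussian_field M \<xi> \<longleftrightarrow> (\<forall>J. finite J \<longrightarrow> jointly_gaussian M J \<xi>)"

(* Translation invariance of the law of the whole field on the product sigma-algebra. *)
definition homogeneous_field :: "'a measure \<Rightarrow> ('s::ab_group_add \<Rightarrow> 'a \<Rightarrow> real) \<Rightarrow> bool" where
  "homogeneous_field M \<xi> \<longleftrightarrow>
     (\<forall>z. distr M (\<Pi>\<^sub>M x\<in>UNIV. borel) (\<lambda>\<omega> x. \<xi> (x + z) \<omega>)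
        = distr M (\<Pi>\<^sub>M x\<in>UNIV. borel) (\<lambda>\<omega> x. \<xi> x \<omega>))"

definition covariance :: "'a measure \<Rightarrow> ('a \<Rightarrow> real) \<Rightarrow> ('a \<Rightarrow> real) \<Rightarrow> real" where
  "covariance M X Y =
     prob_space.expectation M
       (\<lambda>\<omega>. (X \<omega> - prob_space.expectation M X) * (Y \<omega> - prob_space.expectation M Y))"

end

theory Submission
  imports Defs
begin

text \<open>
  The theorem is Isserlis' (Wick's) theorem for a Gaussian family whose mean need not vanish. In
  such a family no joint cumulants other than the means and the covariances can be non-zero, so a product
  moment is a sum over partitions into singletons, each contributing a mean, and pairs, each
  contributing a covariance. With mean \<open>exp (- \<beta> V)\<close> and covariance
  \<open>exp (- \<beta> W (x - y))\<close> these factors are the Boltzmann weights of a monomer and of a dimer, and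
  the product over the blocks is the Boltzmann weight of the configuration, because the energy is
  additive over blocks (\<open>boltzmann_config_energy\<close>).

  The proof of \<open>isserlis\<close> shows that both sides obey the same recursion in the finite set of sites.
  For the combinatorial side, classify configurations by the block of a new site \<open>x\<close>: either \<open>x\<close>
  is a monomer or it is paired with some \<open>y\<close> (\<open>sum_configurations_insert\<close>). The probabilistic side
  is Gaussian integration by parts,
  \<open>E[\<xi>\<^sub>x \<Prod>\<^sub>A \<xi>] = E[\<xi>\<^sub>x] E[\<Prod>\<^sub>A \<xi>] + \<Sum>\<^sub>y cov(\<xi>\<^sub>x, \<xi>\<^sub>y) E[\<Prod>\<^sub>A\<^sub>-\<^sub>y \<xi>]\<close>
  (\<open>gaussian_integration_by_parts_prod\<close>).

  Since joint Gaussianity is the statement that every linear combination is a normal variable,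
  possibly degenerate, integration by parts is derived from one-dimensional moments alone, without
  a joint density or an inverse covariance matrix. The moments of a normal variable \<open>S\<close> satisfy
  \<open>E[S\<^sup>n\<^sup>+\<^sup>1] = E[S] E[S\<^sup>n] + n Var(S) E[S\<^sup>n\<^sup>-\<^sup>1]\<close>. Applying this to \<open>S + t Y\<close> and
  differentiating at \<open>t = 0\<close> gives a formula for \<open>E[Y S\<^sup>n]\<close>
  (\<open>gaussian_integration_by_parts_power\<close>). Taking \<open>S\<close> to be the sums of \<open>\<xi>\<close> over the subsets of
  \<open>A\<close> and forming the alternating sum over these subsets turns powers into products
  (\<open>polarization\<close>).
\<close>

section \<open>Moments of normal variables\<close>

text \<open>
  The recursion \<open>E[(X - \<mu>)\<^sup>k\<^sup>+\<^sup>1] = k \<sigma>\<^sup>2 E[(X - \<mu>)\<^sup>k\<^sup>-\<^sup>1]\<close> packages the closed forms of the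
  even and odd moments into one statement that also covers the Dirac law, where both sides are zero.
\<close>

lemma normal_law_centered_moments:
  assumes "\<sigma> \<ge> 0"
  shows integrable_normal_law_centered: "integrable (normal_law \<mu> \<sigma>) (\<lambda>x. (x - \<mu>) ^ k)"
    and normal_law_centered_moment_Suc:
      "(LINT x|normal_law \<mu> \<sigma>. (x - \<mu>) ^ Suc k) =
         real k * \<sigma>\<^sup>2 * (LINT x|normal_law \<mu> \<sigma>. (x - \<mu>) ^ (k - 1))"
proof -
  have "integrable (normal_law \<mu> \<sigma>) (\<lambda>x. (x - \<mu>) ^ k) \<and>
    (LINT x|normal_law \<mu> \<sigma>. (x - \<mu>) ^ Suc k) =
         real k * \<sigma>\<^sup>2 * (LINT x|normal_law \<mu> \<sigma>. (x - \<mu>) ^ (k - 1))"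
  proof (cases "\<sigma> = 0")
    case True
    then show ?thesis
      by (simp add: normal_law_def integral_return integrable_iff_bounded nn_integral_return)
  next
    case False
    with assms have s: "\<sigma> > 0" by simp
    define c where "c j = (LINT x|lborel. normal_density \<mu> \<sigma> x * (x - \<mu>) ^ j)" for j
    have law: "(LINT x|normal_law \<mu> \<sigma>. (x - \<mu>) ^ j) = c j" for j
      using False unfolding normal_law_def c_def
      by (simp, subst integral_density) (auto simp: s)
    have int: "integrable (normal_law \<mu> \<sigma>) (\<lambda>x. (x - \<mu>) ^ k)"
      using False integrable_normal_moment[OF s] unfolding normal_law_def
      by (simp, subst integrable_density) (auto simp: s)
    have odd: "c (2 * j + 1) = 0" for j
      unfolding c_def by (rule integral_normal_moment_odd[OF s])
    have even: "c (2 * j) = fact (2 * j) / ((2 / \<sigma>\<^sup>2) ^ j * fact j)" for j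
      unfolding c_def by (rule integral_normal_moment_even[OF s])
    have "c (Suc k) = real k * \<sigma>\<^sup>2 * c (k - 1)"
    proof (cases k)
      case 0
      then show ?thesis using odd[of 0] by simp
    next
      case (Suc m)
      show ?thesis
      proof (cases "even m")
        case True
        then obtain j where j: "m = 2 * j" by (elim evenE)
        have "c (2 * Suc j) = real (2 * j + 1) * \<sigma>\<^sup>2 * c (2 * j)"
        proof -
          have cancel: "(2 * r * (q * P)) / (d * (2 / v) * (r * Q)) = q * v * (P / (d * Q))"
            if "r \<noteq> 0" "v \<noteq> 0" "d \<noteq> 0" "Q \<noteq> 0" for r q P d v Q :: real
            using that by (simp add: field_simps)
          have fact_2: "(fact (2 * Suc j) :: real) = 2 * real (Suc j) * (real (2 * j + 1) * fact (2 * j))"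
            by (simp add: algebra_simps)
          have denominator: "(2 / \<sigma>\<^sup>2) ^ Suc j * fact (Suc j) = (2 / \<sigma>\<^sup>2) ^ j * (2 / \<sigma>\<^sup>2) * (real (Suc j) * fact j)"
            by simp
          show ?thesis
            unfolding even fact_2 denominator by (rule cancel) (use s in auto)
        qed
        then show ?thesis using Suc j by simp
      next
        case False
        then obtain j where j: "m = 2 * j + 1" by (elim oddE)
        show ?thesis using odd[of j] odd[of "Suc j"] Suc j by simp
      qed
    qed
    then show ?thesis using int by (simp only: law)
  qed
  then show "integrable (normal_law \<mu> \<sigma>) (\<lambda>x. (x - \<mu>) ^ k)"
    and "(LINT x|normal_law \<mu> \<sigma>. (x - \<mu>) ^ Suc k) =
         real k * \<sigma>\<^sup>2 * (LINT x|normal_law \<mu> \<sigma>. (x - \<mu>) ^ (k - 1))"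
    by blast+
qed

lemma prob_space_normal_law:
  assumes "\<sigma> \<ge> 0"
  shows "prob_space (normal_law \<mu> \<sigma>)"
  using assms prob_space_normal_density[of \<sigma> \<mu>]
  by (auto simp: normal_law_def intro!: prob_space_return)

text \<open>
  Expanding \<open>x\<^sup>n\<close> in powers of \<open>x - \<mu>\<close>, the centred recursion becomes
  \<open>E[(X - \<mu>) X\<^sup>n] = n \<sigma>\<^sup>2 E[X\<^sup>n\<^sup>-\<^sup>1]\<close>, the instance of Stein's identity
  \<open>E[(X - \<mu>) p(X)] = \<sigma>\<^sup>2 E[p'(X)]\<close> for a monomial \<open>p\<close>.
\<close>

lemma normal_law_moments:
  assumes s: "\<sigma> \<ge> 0"
  shows integrable_normal_law_power: "integrable (normal_law \<mu> \<sigma>) (\<lambda>x. x ^ n)"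
    and normal_law_moment_Suc:
      "(LINT x|normal_law \<mu> \<sigma>. x ^ Suc n) =
         \<mu> * (LINT x|normal_law \<mu> \<sigma>. x ^ n) + real n * \<sigma>\<^sup>2 * (LINT x|normal_law \<mu> \<sigma>. x ^ (n - 1))"
proof -
  let ?N = "normal_law \<mu> \<sigma>"
  note int [simp, intro] = integrable_normal_law_centered[OF s, of \<mu>]
  have int_Suc: "integrable ?N (\<lambda>x. (x - \<mu>) * (x - \<mu>) ^ k)" for k
    using int[of "Suc k"] by simp
  have expand: "(\<lambda>x. x ^ n) = (\<lambda>x. \<Sum>k\<le>n. (real (n choose k) * \<mu> ^ (n - k)) * (x - \<mu>) ^ k)" for n
    using binomial_ring[of "_ - \<mu>" \<mu> n] by (simp add: mult_ac)
  have int_pow: "integrable ?N (\<lambda>x. x ^ n)" for n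
    unfolding expand by (intro Bochner_Integration.integrable_sum integrable_mult_right int)
  show "integrable ?N (\<lambda>x. x ^ n)" by (rule int_pow)
  have moment: "(LINT x|?N. x ^ n) =
      (\<Sum>k\<le>n. (real (n choose k) * \<mu> ^ (n - k)) * (LINT x|?N. (x - \<mu>) ^ k))" for n
    unfolding expand by (subst Bochner_Integration.integral_sum) auto
  have shifted: "(x - \<mu>) * x ^ n =
      (\<Sum>k\<le>n. (real (n choose k) * \<mu> ^ (n - k)) * (x - \<mu>) ^ Suc k)" for x
    by (subst fun_cong[OF expand[of n], of x]) (simp add: sum_distrib_left mult_ac)
  have int_shifted: "integrable ?N (\<lambda>x. (x - \<mu>) * x ^ n)"
    unfolding shifted by (intro Bochner_Integration.integrable_sum integrable_mult_right int)
  have "(LINT x|?N. (x - \<mu>) * x ^ n) =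
      (\<Sum>k\<le>n. (real (n choose k) * \<mu> ^ (n - k)) * (LINT x|?N. (x - \<mu>) ^ Suc k))"
    unfolding shifted
    by (subst Bochner_Integration.integral_sum)
       (intro integrable_mult_right int, intro sum.cong refl integral_mult_right_zero)
  also have "\<dots> = (\<Sum>k\<le>n. (real (n choose k) * \<mu> ^ (n - k)) *
      (real k * \<sigma>\<^sup>2 * (LINT x|?N. (x - \<mu>) ^ (k - 1))))"
    by (simp only: normal_law_centered_moment_Suc[OF s])
  also have "\<dots> = real n * \<sigma>\<^sup>2 * (LINT x|?N. x ^ (n - 1))"
  proof (cases n)
    case (Suc m)
    have absorb: "real (Suc m choose Suc j) * real (Suc j) = real (Suc m) * real (m choose j)" for j
      using Suc_times_binomial_eq[of m j] by (metis of_nat_mult)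
    have step: "(real (Suc m choose Suc j) * \<mu> ^ (Suc m - Suc j)) *
        (real (Suc j) * \<sigma>\<^sup>2 * (LINT x|?N. (x - \<mu>) ^ (Suc j - 1))) =
      real (Suc m) * \<sigma>\<^sup>2 * ((real (m choose j) * \<mu> ^ (m - j)) * (LINT x|?N. (x - \<mu>) ^ j))" for j
    proof -
      have "(real (Suc m choose Suc j) * \<mu> ^ (Suc m - Suc j)) *
          (real (Suc j) * \<sigma>\<^sup>2 * (LINT x|?N. (x - \<mu>) ^ (Suc j - 1))) =
        (real (Suc m choose Suc j) * real (Suc j)) *
          (\<sigma>\<^sup>2 * (\<mu> ^ (m - j) * (LINT x|?N. (x - \<mu>) ^ j)))"
        by simp
      then show ?thesis unfolding absorb by simp
    qed
    show ?thesis
      unfolding Suc moment sum.atMost_Suc_shift sum_distrib_left step by simp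
  qed simp
  finally have centered: "(LINT x|?N. (x - \<mu>) * x ^ n) = real n * \<sigma>\<^sup>2 * (LINT x|?N. x ^ (n - 1))" .
  have "(LINT x|?N. x ^ Suc n) = (LINT x|?N. \<mu> * x ^ n + (x - \<mu>) * x ^ n)"
    by (simp add: algebra_simps)
  also have "\<dots> = \<mu> * (LINT x|?N. x ^ n) + (LINT x|?N. (x - \<mu>) * x ^ n)"
    by (subst Bochner_Integration.integral_add) (auto intro: int_pow int_shifted)
  finally show "(LINT x|?N. x ^ Suc n) =
      \<mu> * (LINT x|?N. x ^ n) + real n * \<sigma>\<^sup>2 * (LINT x|?N. x ^ (n - 1))"
    unfolding centered .
qed

lemma (in prob_space) covariance_eq:
  fixes X Y :: "'a \<Rightarrow> real"
  assumes "integrable M X" "integrable M Y" "integrable M (\<lambda>\<omega>. X \<omega> * Y \<omega>)"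
  shows "covariance M X Y = expectation (\<lambda>\<omega>. X \<omega> * Y \<omega>) - expectation X * expectation Y"
proof -
  have "(X \<omega> - expectation X) * (Y \<omega> - expectation Y) =
      X \<omega> * Y \<omega> - expectation Y * X \<omega> - (expectation X * Y \<omega> - expectation X * expectation Y)" for \<omega>
    by (simp add: algebra_simps)
  then show ?thesis
    unfolding covariance_def using assms by (simp add: prob_space)
qed

text \<open>
  The parameters of the law are eliminated here: the first two instances of the recursion identify
  them as the mean and the variance of \<open>X\<close>.
\<close>

lemma (in prob_space) gaussian_rv_moments:
  assumes "gaussian_rv M X"
  shows gaussian_rv_integrable_power: "integrable M (\<lambda>\<omega>. X \<omega> ^ n)"
    and gaussian_rv_moment_Suc:
      "expectation (\<lambda>\<omega>. X \<omega> ^ Suc n) =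
         expectation X * expectation (\<lambda>\<omega>. X \<omega> ^ n) +
         real n * covariance M X X * expectation (\<lambda>\<omega>. X \<omega> ^ (n - 1))"
proof -
  obtain \<mu> \<sigma> where X: "X \<in> borel_measurable M" and s: "\<sigma> \<ge> 0"
    and law: "distr M borel X = normal_law \<mu> \<sigma>"
    using assms unfolding gaussian_rv_def by blast
  interpret N: prob_space "normal_law \<mu> \<sigma>" by (rule prob_space_normal_law[OF s])
  have int: "integrable M (\<lambda>\<omega>. X \<omega> ^ k)" for k
    using integrable_normal_law_power[OF s, of \<mu> k] X
    unfolding law[symmetric] by (subst (asm) integrable_distr_eq) auto
  have transfer: "expectation (\<lambda>\<omega>. X \<omega> ^ k) = (LINT x|normal_law \<mu> \<sigma>. x ^ k)" for k
    unfolding law[symmetric] using X by (subst integral_distr) auto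
  note rec = normal_law_moment_Suc[OF s, of \<mu>]
  have mean: "expectation X = \<mu>"
    using rec[of 0] transfer[of 1] by (simp add: N.prob_space)
  have "expectation (\<lambda>\<omega>. X \<omega> ^ 2) = \<mu>\<^sup>2 + \<sigma>\<^sup>2"
    using rec[of 1] rec[of 0] transfer[of 2] by (simp add: N.prob_space power2_eq_square)
  then have var: "covariance M X X = \<sigma>\<^sup>2"
    using covariance_eq[of X X] int[of 1] int[of 2] mean by (simp add: power2_eq_square)
  show "integrable M (\<lambda>\<omega>. X \<omega> ^ n)" by (rule int)
  show "expectation (\<lambda>\<omega>. X \<omega> ^ Suc n) =
         expectation X * expectation (\<lambda>\<omega>. X \<omega> ^ n) +
         real n * covariance M X X * expectation (\<lambda>\<omega>. X \<omega> ^ (n - 1))"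
    unfolding transfer mean var by (rule rec)
qed

lemma (in prob_space) gaussian_rv_integrable:
  assumes "gaussian_rv M X"
  shows "integrable M X"
  using gaussian_rv_integrable_power[OF assms, of 1] by simp

section \<open>Integration by parts against a power\<close>

text \<open>
  Marginal moments suffice, whatever the joint law, because \<open>\<bar>x\<^sup>j y\<^sup>k\<bar>\<close> is at most the
  \<open>(j + k)\<close>-th power of the larger of \<open>\<bar>x\<bar>\<close> and \<open>\<bar>y\<bar>\<close>.
\<close>

lemma (in prob_space) gaussian_rv_integrable_mult_powers:
  assumes X: "gaussian_rv M X" and Y: "gaussian_rv M Y"
  shows "integrable M (\<lambda>\<omega>. X \<omega> ^ j * Y \<omega> ^ k)"
proof (rule Bochner_Integration.integrable_bound)
  show "integrable M (\<lambda>\<omega>. \<bar>X \<omega> ^ (j + k)\<bar> + \<bar>Y \<omega> ^ (j + k)\<bar>)"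
    by (intro Bochner_Integration.integrable_add integrable_abs gaussian_rv_integrable_power X Y)
  show "(\<lambda>\<omega>. X \<omega> ^ j * Y \<omega> ^ k) \<in> borel_measurable M"
    using X Y by (auto simp: gaussian_rv_def)
  have bound: "\<bar>x ^ j * y ^ k\<bar> \<le> \<bar>x ^ (j + k)\<bar> + \<bar>y ^ (j + k)\<bar>" for x y :: real
  proof (cases "\<bar>x\<bar> \<le> \<bar>y\<bar>")
    case True
    then have "\<bar>x\<bar> ^ j * \<bar>y\<bar> ^ k \<le> \<bar>y\<bar> ^ j * \<bar>y\<bar> ^ k"
      by (intro mult_right_mono power_mono) auto
    then show ?thesis by (simp add: abs_mult power_abs power_add add_increasing)
  next
    case False
    then have "\<bar>x\<bar> ^ j * \<bar>y\<bar> ^ k \<le> \<bar>x\<bar> ^ j * \<bar>x\<bar> ^ k"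
      by (intro mult_left_mono power_mono) auto
    then show ?thesis by (simp add: abs_mult power_abs power_add add_increasing2)
  qed
  show "AE \<omega> in M. norm (X \<omega> ^ j * Y \<omega> ^ k) \<le> norm (\<bar>X \<omega> ^ (j + k)\<bar> + \<bar>Y \<omega> ^ (j + k)\<bar>)"
    using bound by (intro AE_I2) (simp add: order_trans[OF bound])
qed

lemma (in prob_space) covariance_add_scaled:
  assumes S: "gaussian_rv M S" and Y: "gaussian_rv M Y"
  shows "covariance M (\<lambda>\<omega>. S \<omega> + t * Y \<omega>) (\<lambda>\<omega>. S \<omega> + t * Y \<omega>) =
    covariance M S S + 2 * t * covariance M Y S + t\<^sup>2 * covariance M Y Y"
proof -
  note int [simp] = gaussian_rv_integrable[OF S] gaussian_rv_integrable[OF Y]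
  have prods [simp]: "integrable M (\<lambda>\<omega>. S \<omega> * S \<omega>)" "integrable M (\<lambda>\<omega>. Y \<omega> * S \<omega>)"
    "integrable M (\<lambda>\<omega>. Y \<omega> * Y \<omega>)"
    using gaussian_rv_integrable_mult_powers[OF S S, of 1 1]
      gaussian_rv_integrable_mult_powers[OF Y S, of 1 1]
      gaussian_rv_integrable_mult_powers[OF Y Y, of 1 1] by simp_all
  have sq: "(S \<omega> + t * Y \<omega>) * (S \<omega> + t * Y \<omega>) =
      S \<omega> * S \<omega> + (2 * t) * (Y \<omega> * S \<omega>) + t\<^sup>2 * (Y \<omega> * Y \<omega>)" for \<omega>
    by (simp add: algebra_simps power2_eq_square)
  have "covariance M (\<lambda>\<omega>. S \<omega> + t * Y \<omega>) (\<lambda>\<omega>. S \<omega> + t * Y \<omega>) =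
      (expectation (\<lambda>\<omega>. S \<omega> * S \<omega>) + (2 * t) * expectation (\<lambda>\<omega>. Y \<omega> * S \<omega>) +
        t\<^sup>2 * expectation (\<lambda>\<omega>. Y \<omega> * Y \<omega>)) -
      (expectation S + t * expectation Y) * (expectation S + t * expectation Y)"
    by (subst covariance_eq) (simp_all add: sq)
  moreover have "covariance M S S = expectation (\<lambda>\<omega>. S \<omega> * S \<omega>) - expectation S * expectation S"
    "covariance M Y S = expectation (\<lambda>\<omega>. Y \<omega> * S \<omega>) - expectation Y * expectation S"
    "covariance M Y Y = expectation (\<lambda>\<omega>. Y \<omega> * Y \<omega>) - expectation Y * expectation Y"
    by (simp_all add: covariance_eq)
  ultimately show ?thesis
    by (simp only:) (simp add: algebra_simps power2_eq_square)
qed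

text \<open>
  The moment is a polynomial in \<open>t\<close>, so its derivative at 0 is the coefficient of \<open>t\<close> and no
  interchange of limit and expectation is involved.
\<close>

lemma (in prob_space) moment_derivative:
  assumes S: "gaussian_rv M S" and Y: "gaussian_rv M Y"
  shows "((\<lambda>t. expectation (\<lambda>\<omega>. (S \<omega> + t * Y \<omega>) ^ n)) has_real_derivative
    real n * expectation (\<lambda>\<omega>. Y \<omega> * S \<omega> ^ (n - 1))) (at 0)"
proof -
  define e where "e k = expectation (\<lambda>\<omega>. Y \<omega> ^ k * S \<omega> ^ (n - k))" for k
  have "expectation (\<lambda>\<omega>. (S \<omega> + t * Y \<omega>) ^ n) = (\<Sum>k\<le>n. (real (n choose k) * e k) * t ^ k)" for t
  proof -
    have "(S \<omega> + t * Y \<omega>) ^ n = (\<Sum>k\<le>n. (real (n choose k) * t ^ k) * (Y \<omega> ^ k * S \<omega> ^ (n - k)))" for \<omega>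
      using binomial_ring[of "t * Y \<omega>" "S \<omega>" n] by (simp add: mult_ac add_ac power_mult_distrib)
    then show ?thesis
      by (simp add: e_def gaussian_rv_integrable_mult_powers[OF Y S] mult_ac)
  qed
  moreover have "((\<lambda>t. \<Sum>k\<le>n. (real (n choose k) * e k) * t ^ k) has_real_derivative
      (\<Sum>k\<le>n. (real (n choose k) * e k) * (real k * 0 ^ (k - 1)))) (at 0)"
    by (auto intro!: derivative_eq_intros simp: mult_ac)
  moreover have "(\<Sum>k\<le>n. (real (n choose k) * e k) * (real k * 0 ^ (k - 1))) =
      real n * expectation (\<lambda>\<omega>. Y \<omega> * S \<omega> ^ (n - 1))"
  proof (cases "n = 0")
    case False
    have "(\<Sum>k\<le>n. (real (n choose k) * e k) * (real k * 0 ^ (k - 1))) =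
        (\<Sum>k\<in>{1}. (real (n choose k) * e k) * (real k * 0 ^ (k - 1)))"
      using False by (intro sum.mono_neutral_right) (auto simp: not_less_eq_eq)
    then show ?thesis by (simp add: e_def)
  qed simp
  ultimately show ?thesis by simp
qed

text \<open>
  Differentiating the moment recursion of \<open>S + t Y\<close> at \<open>t = 0\<close> gives a linear recursion for
  \<open>E[Y S\<^sup>n]\<close>. The right-hand side solves it, by the moment recursion of \<open>S\<close> itself.
\<close>

lemma (in prob_space) gaussian_integration_by_parts_power:
  assumes joint: "\<And>t. gaussian_rv M (\<lambda>\<omega>. S \<omega> + t * Y \<omega>)" and Y: "gaussian_rv M Y"
  shows "expectation (\<lambda>\<omega>. Y \<omega> * S \<omega> ^ n) =
    expectation Y * expectation (\<lambda>\<omega>. S \<omega> ^ n) +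
    real n * covariance M Y S * expectation (\<lambda>\<omega>. S \<omega> ^ (n - 1))"
proof -
  have S: "gaussian_rv M S" using joint[of 0] by simp
  define m where "m n t = expectation (\<lambda>\<omega>. (S \<omega> + t * Y \<omega>) ^ n)" for n t
  define D where "D n = expectation (\<lambda>\<omega>. Y \<omega> * S \<omega> ^ n)" for n
  define a b where "a = expectation S" and "b = expectation Y"
  define v c u where "v = covariance M S S" and "c = covariance M Y S" and "u = covariance M Y Y"
  have rec: "m (Suc n) t = (a + t * b) * m n t + real n * (v + 2 * t * c + t\<^sup>2 * u) * m (n - 1) t" for n t
    using gaussian_rv_moment_Suc[OF joint[of t], of n] gaussian_rv_integrable[OF S] gaussian_rv_integrable[OF Y]
    unfolding m_def a_def b_def v_def c_def u_def covariance_add_scaled[OF S Y] by simp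
  have deriv: "(m n has_real_derivative real n * D (n - 1)) (at 0)" for n
    unfolding m_def D_def by (rule moment_derivative[OF S Y])
  have D_rec: "real (Suc n) * D n =
      b * m n 0 + a * (real n * D (n - 1)) +
      real n * (2 * c * m (n - 1) 0 + v * (real (n - 1) * D (n - 2)))" for n
  proof -
    have "(m (Suc n) has_real_derivative
      b * m n 0 + a * (real n * D (n - 1)) +
      real n * (2 * c * m (n - 1) 0 + v * (real (n - 1) * D (n - 1 - 1)))) (at 0)"
      unfolding rec[abs_def]
      by (rule derivative_eq_intros refl deriv | simp add: algebra_simps)+
    from DERIV_unique[OF this deriv] show ?thesis by (simp add: numeral_2_eq_2)
  qed
  have "D n = b * m n 0 + real n * c * m (n - 1) 0"
  proof (induction n rule: less_induct)
    case (less n)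
    show ?case
    proof (cases n)
      case 0
      then show ?thesis using D_rec[of 0] by simp
    next
      case (Suc k)
      have IH1: "D k = b * m k 0 + real k * c * m (k - 1) 0"
        using less Suc by simp
      \<comment> \<open>The factor \<open>k\<close> makes the facts at index \<open>k - 1\<close> true also for \<open>k = 0\<close>, where the
        subtraction is truncated.\<close>
      have IH2: "real k * D (k - 1) = real k * (b * m (k - 1) 0 + real (k - 1) * c * m (k - 2) 0)"
        using less[of "k - 1"] Suc by (cases k) (simp_all add: numeral_2_eq_2)
      have r1: "m (Suc k) 0 = a * m k 0 + real k * v * m (k - 1) 0"
        using rec[of k 0] by simp
      have r2: "real k * m k 0 = real k * (a * m (k - 1) 0 + real (k - 1) * v * m (k - 2) 0)"
        using rec[of "k - 1" 0] by (cases k) (simp_all add: numeral_2_eq_2)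
      have "real (Suc (Suc k)) * D (Suc k) =
          b * m (Suc k) 0 + a * (real (Suc k) * D k) +
          real (Suc k) * (2 * c * m k 0 + v * (real k * D (k - 1)))"
        using D_rec[of "Suc k"] by simp
      also have "\<dots> = b * m (Suc k) 0 + real (Suc k) * b * (a * m k 0 + real k * v * m (k - 1) 0) +
          real (Suc k) * c * (2 * m k 0 + real k * (a * m (k - 1) 0 + real (k - 1) * v * m (k - 2) 0))"
        unfolding IH1 IH2 by (simp add: algebra_simps)
      also have "\<dots> = real (Suc (Suc k)) * (b * m (Suc k) 0 + real (Suc k) * c * m k 0)"
        unfolding r1[symmetric] r2[symmetric] by (simp add: algebra_simps)
      finally have "D (Suc k) = b * m (Suc k) 0 + real (Suc k) * c * m k 0"
        by (simp only: mult_cancel_left of_nat_eq_0_iff) simp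
      then show ?thesis using Suc by simp
    qed
  qed
  then show ?thesis
    by (simp add: D_def m_def b_def c_def)
qed

section \<open>Polarization\<close>

lemma sum_Pow_insert:
  assumes "finite A" "a \<notin> A"
  shows "(\<Sum>B\<in>Pow (insert a A). f B) = (\<Sum>B\<in>Pow A. f B + f (insert a B))"
proof -
  have "inj_on (insert a) (Pow A)"
    using assms by (auto simp: inj_on_def)
  then have "(\<Sum>B\<in>Pow (insert a A). f B) = (\<Sum>B\<in>Pow A. f B) + (\<Sum>B\<in>Pow A. f (insert a B))"
    unfolding Pow_insert using assms
    by (subst sum.union_disjoint) (auto simp: sum.reindex)
  then show ?thesis by (simp add: sum.distrib)
qed

text \<open>
  The left-hand side applies the difference operators \<open>p \<mapsto> (\<lambda>u. p (u + X i) - p u)\<close>, for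
  \<open>i \<in> A\<close>, to the polynomial \<open>u\<^sup>k\<close> at \<open>c\<close>. Each operator lowers the degree by one, so lower powers are
  annihilated and for \<open>k = card A\<close> only the leading coefficient survives. The exponents below
  \<open>card A\<close> are included for the sake of the induction. The base point \<open>c\<close> is free, so that a
  variable common to all the sums may be absorbed into it.
\<close>

lemma polarization:
  fixes X :: "'i \<Rightarrow> 'b::{comm_ring_1,ring_char_0}"
  assumes "finite A" "k \<le> card A"
  shows "(\<Sum>B\<in>Pow A. (- 1) ^ card (A - B) * (c + (\<Sum>i\<in>B. X i)) ^ k) =
    (if k = card A then fact k * (\<Prod>i\<in>A. X i) else 0)"
  using assms
proof (induction A arbitrary: k rule: finite_induct)
  case empty
  then show ?case by simp
next
  case (insert a A)
  let ?S = "\<lambda>B. c + (\<Sum>i\<in>B. X i)"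
  have difference: "(u + X a) ^ k - u ^ k = (\<Sum>j<k. of_nat (k choose j) * X a ^ (k - j) * u ^ j)" for u
    by (simp add: binomial_ring[of u "X a" k] lessThan_Suc_atMost[symmetric] mult_ac)
  have "(\<Sum>B\<in>Pow (insert a A). (- 1) ^ card (insert a A - B) * ?S B ^ k) =
      (\<Sum>B\<in>Pow A. (- 1) ^ card (A - B) * ((?S B + X a) ^ k - ?S B ^ k))"
    unfolding sum_Pow_insert[OF insert.hyps]
  proof (intro sum.cong refl)
    fix B assume "B \<in> Pow A"
    then have B: "B \<subseteq> A" "finite B" "a \<notin> B"
      using insert.hyps by (auto intro: finite_subset)
    have "insert a A - B = insert a (A - B)" "insert a A - insert a B = A - B"
      using B insert.hyps by auto
    then show "(- 1) ^ card (insert a A - B) * ?S B ^ k +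
        (- 1) ^ card (insert a A - insert a B) * ?S (insert a B) ^ k =
      (- 1) ^ card (A - B) * ((?S B + X a) ^ k - ?S B ^ k)"
      using B insert.hyps by (simp add: algebra_simps)
  qed
  also have "\<dots> = (\<Sum>j<k. of_nat (k choose j) * X a ^ (k - j) *
      (\<Sum>B\<in>Pow A. (- 1) ^ card (A - B) * ?S B ^ j))"
    unfolding difference sum_distrib_left by (subst sum.swap) (simp add: mult_ac)
  also have "\<dots> = (\<Sum>j<k. of_nat (k choose j) * X a ^ (k - j) *
      (if j = card A then fact j * (\<Prod>i\<in>A. X i) else 0))"
    using insert.prems insert.hyps by (intro sum.cong refl arg_cong2[of _ _ _ _ "(*)"] insert.IH) auto
  also have "\<dots> = (if k = card (insert a A) then fact k * (\<Prod>i\<in>insert a A. X i) else 0)"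
    using insert.prems insert.hyps
    by (auto simp: if_distrib[of "\<lambda>x. _ * x"] sum.delta mult_ac cong: if_cong)
  finally show ?case .
qed

section \<open>Integration by parts against a product\<close>

lemma gaussian_field_finite_sum:
  assumes "gaussian_field M \<xi>" "finite J"
  shows "gaussian_rv M (\<lambda>\<omega>. \<Sum>i\<in>J. c i * \<xi> i \<omega>)"
  using assms unfolding gaussian_field_def jointly_gaussian_def by blast

lemma gaussian_field_sum_add_scaled:
  assumes "gaussian_field M \<xi>" "finite A"
  shows "gaussian_rv M (\<lambda>\<omega>. (\<Sum>i\<in>A. \<xi> i \<omega>) + t * \<xi> x \<omega>)"
proof -
  \<comment> \<open>The site \<open>x\<close> may itself belong to \<open>A\<close>, in which case its coefficient is \<open>1 + t\<close>.\<close>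
  have "(\<Sum>i\<in>insert x A. (of_bool (i \<in> A) + t * of_bool (i = x)) * \<xi> i \<omega>) =
      (\<Sum>i\<in>A. \<xi> i \<omega>) + t * \<xi> x \<omega>" for \<omega>
  proof -
    have "(\<Sum>i\<in>insert x A. of_bool (i \<in> A) * \<xi> i \<omega>) = (\<Sum>i\<in>A. \<xi> i \<omega>)"
      using assms(2) by (intro sum.mono_neutral_cong_right) auto
    moreover have "(\<Sum>i\<in>insert x A. t * of_bool (i = x) * \<xi> i \<omega>) = (\<Sum>i\<in>{x}. t * \<xi> i \<omega>)"
      using assms(2) by (intro sum.mono_neutral_cong_right) auto
    ultimately show ?thesis by (simp add: distrib_right sum.distrib del: sum.insert_if)
  qed
  then show ?thesis
    using gaussian_field_finite_sum[OF assms(1), of "insert x A" "\<lambda>i. of_bool (i \<in> A) + t * of_bool (i = x)"]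
      assms(2) by (simp del: sum.insert_if)
qed

lemma gaussian_field_sum:
  assumes "gaussian_field M \<xi>" "finite A"
  shows "gaussian_rv M (\<lambda>\<omega>. \<Sum>i\<in>A. \<xi> i \<omega>)"
  using gaussian_field_sum_add_scaled[OF assms, of 0] by simp

lemma gaussian_field_component:
  assumes "gaussian_field M \<xi>"
  shows "gaussian_rv M (\<xi> x)"
  using gaussian_field_sum[OF assms, of "{x}"] by simp

lemma (in prob_space) covariance_sum_right:
  assumes G: "gaussian_field M \<xi>" and "finite A"
  shows "covariance M (\<xi> x) (\<lambda>\<omega>. \<Sum>i\<in>A. \<xi> i \<omega>) = (\<Sum>i\<in>A. covariance M (\<xi> x) (\<xi> i))"
proof -
  have [simp]: "integrable M (\<xi> i)" "integrable M (\<lambda>\<omega>. \<xi> i \<omega> * \<xi> j \<omega>)" for i j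
    using gaussian_field_component[OF G]
      gaussian_rv_integrable_mult_powers[OF gaussian_field_component[OF G, of i] gaussian_field_component[OF G, of j], of 1 1]
    by (auto intro: gaussian_rv_integrable)
  show ?thesis
    by (subst covariance_eq)
       (simp_all add: covariance_eq sum_distrib_left sum_subtractf)
qed

lemma (in prob_space) gaussian_field_integrable_prod:
  assumes G: "gaussian_field M \<xi>" and "finite A"
  shows "integrable M (\<lambda>\<omega>. \<Prod>i\<in>A. \<xi> i \<omega>)"
proof -
  have pol: "(\<Prod>i\<in>A. \<xi> i \<omega>) =
      (\<Sum>B\<in>Pow A. (- 1) ^ card (A - B) * (\<Sum>i\<in>B. \<xi> i \<omega>) ^ card A) / fact (card A)" for \<omega>
    using polarization[OF \<open>finite A\<close> order_refl, of 0 "\<lambda>i. \<xi> i \<omega>"] by simp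
  have "integrable M (\<lambda>\<omega>. (\<Sum>i\<in>B. \<xi> i \<omega>) ^ card A)" if "B \<in> Pow A" for B
    using that \<open>finite A\<close>
    by (intro gaussian_rv_integrable_power gaussian_field_sum G) (auto intro: finite_subset)
  then show ?thesis
    unfolding pol
    by (intro Bochner_Integration.integrable_divide Bochner_Integration.integrable_sum
        integrable_mult_right) auto
qed

text \<open>
  Polarizing in the power formula with \<open>S = \<Sum>\<^sub>B \<xi>\<close>, \<open>B \<subseteq> A\<close>, turns \<open>S\<^sup>n\<close> into \<open>n! \<Prod>\<^sub>A \<xi>\<close>. In the
  covariance term the sum over \<open>B\<close> and \<open>y \<in> B\<close> is interchanged. For fixed \<open>y\<close> the sets containing
  \<open>y\<close> are \<open>insert y B\<close> with \<open>B \<subseteq> A - {y}\<close>, so this is again a polarization sum, now over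
  \<open>A - {y}\<close> with base point \<open>\<xi> y\<close>.
\<close>

lemma (in prob_space) gaussian_integration_by_parts_prod:
  assumes G: "gaussian_field M \<xi>" and fin: "finite A"
  shows "expectation (\<lambda>\<omega>. \<xi> x \<omega> * (\<Prod>i\<in>A. \<xi> i \<omega>)) =
    expectation (\<xi> x) * expectation (\<lambda>\<omega>. \<Prod>i\<in>A. \<xi> i \<omega>) +
    (\<Sum>y\<in>A. covariance M (\<xi> x) (\<xi> y) * expectation (\<lambda>\<omega>. \<Prod>i\<in>A - {y}. \<xi> i \<omega>))"
proof -
  let ?n = "card A"
  let ?S = "\<lambda>B \<omega>. \<Sum>i\<in>B. \<xi> i \<omega>"
  let ?C = "\<lambda>y. covariance M (\<xi> x) (\<xi> y)"
  note component = gaussian_field_component[OF G]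
  have sumG: "gaussian_rv M (?S B)" if "B \<in> Pow A" for B
    using that fin by (intro gaussian_field_sum G) (auto intro: finite_subset)
  have int_pow: "integrable M (\<lambda>\<omega>. ?S B \<omega> ^ k)" if "B \<in> Pow A" for B k
    by (intro gaussian_rv_integrable_power sumG that)
  have int_mult: "integrable M (\<lambda>\<omega>. \<xi> x \<omega> * ?S B \<omega> ^ k)" if "B \<in> Pow A" for B k
    using gaussian_rv_integrable_mult_powers[OF component sumG[OF that], of x 1 k] by simp
  have pol: "fact ?n * (\<Prod>i\<in>A. \<xi> i \<omega>) = (\<Sum>B\<in>Pow A. (- 1) ^ card (A - B) * ?S B \<omega> ^ ?n)" for \<omega>
    using polarization[OF fin order_refl, of 0 "\<lambda>i. \<xi> i \<omega>"] by simp
  have parts: "expectation (\<lambda>\<omega>. \<xi> x \<omega> * ?S B \<omega> ^ ?n) =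
      expectation (\<xi> x) * expectation (\<lambda>\<omega>. ?S B \<omega> ^ ?n) +
      (\<Sum>y\<in>B. ?C y * (real ?n * expectation (\<lambda>\<omega>. ?S B \<omega> ^ (?n - 1))))" if "B \<in> Pow A" for B
  proof -
    have "finite B" using that fin by (auto intro: finite_subset)
    then show ?thesis
      using gaussian_integration_by_parts_power[OF gaussian_field_sum_add_scaled[OF G] component]
      by (simp add: covariance_sum_right[OF G] sum_distrib_right sum_distrib_left mult_ac)
  qed
  have removed: "(\<Sum>B\<in>{B \<in> Pow A. y \<in> B}. (- 1) ^ card (A - B) *
      (real ?n * expectation (\<lambda>\<omega>. ?S B \<omega> ^ (?n - 1)))) =
      fact ?n * expectation (\<lambda>\<omega>. \<Prod>i\<in>A - {y}. \<xi> i \<omega>)" if y: "y \<in> A" for y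
  proof -
    let ?A = "A - {y}"
    have n: "?n = Suc (card ?A)" using fin y by (rule card.remove)
    have "bij_betw (insert y) (Pow ?A) {B \<in> Pow A. y \<in> B}"
      using y by (intro bij_betwI[of _ _ _ "\<lambda>B. B - {y}"]) auto
    then have "(\<Sum>B\<in>{B \<in> Pow A. y \<in> B}. (- 1) ^ card (A - B) *
        (real ?n * expectation (\<lambda>\<omega>. ?S B \<omega> ^ (?n - 1)))) =
      (\<Sum>B\<in>Pow ?A. (- 1) ^ card (A - insert y B) *
        (real ?n * expectation (\<lambda>\<omega>. ?S (insert y B) \<omega> ^ (?n - 1))))"
      by (rule sum.reindex_bij_betw[symmetric])
    also have "\<dots> = real ?n * (\<Sum>B\<in>Pow ?A. (- 1) ^ card (?A - B) *
        expectation (\<lambda>\<omega>. ?S (insert y B) \<omega> ^ card ?A))"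
    proof -
      have diff: "A - insert y B = ?A - B" for B by auto
      have pred: "?n - 1 = card ?A" unfolding n by (rule diff_Suc_1)
      show ?thesis
        unfolding sum_distrib_left pred
        by (intro sum.cong refl, subst diff) (rule mult.left_commute)
    qed
    also have "\<dots> = real ?n * expectation (\<lambda>\<omega>. \<Sum>B\<in>Pow ?A. (- 1) ^ card (?A - B) *
        ?S (insert y B) \<omega> ^ card ?A)"
    proof -
      have "insert y B \<in> Pow A" if "B \<in> Pow ?A" for B using that y by auto
      then show ?thesis
        by (subst Bochner_Integration.integral_sum) (auto intro!: integrable_mult_right int_pow)
    qed
    also have "(\<lambda>\<omega>. \<Sum>B\<in>Pow ?A. (- 1) ^ card (?A - B) * ?S (insert y B) \<omega> ^ card ?A) =
        (\<lambda>\<omega>. fact (card ?A) * (\<Prod>i\<in>?A. \<xi> i \<omega>))"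
    proof
      fix \<omega>
      have "(\<Sum>B\<in>Pow ?A. (- 1) ^ card (?A - B) * ?S (insert y B) \<omega> ^ card ?A) =
          (\<Sum>B\<in>Pow ?A. (- 1) ^ card (?A - B) * (\<xi> y \<omega> + ?S B \<omega>) ^ card ?A)"
      proof (intro sum.cong refl)
        fix B assume "B \<in> Pow ?A"
        then have "finite B" "y \<notin> B" using fin by (auto intro: finite_subset)
        then show "(- 1) ^ card (?A - B) * ?S (insert y B) \<omega> ^ card ?A =
            (- 1) ^ card (?A - B) * (\<xi> y \<omega> + ?S B \<omega>) ^ card ?A" by simp
      qed
      also have "\<dots> = fact (card ?A) * (\<Prod>i\<in>?A. \<xi> i \<omega>)"
        using polarization[of ?A "card ?A" "\<xi> y \<omega>" "\<lambda>i. \<xi> i \<omega>"] fin by simp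
      finally show "(\<Sum>B\<in>Pow ?A. (- 1) ^ card (?A - B) * ?S (insert y B) \<omega> ^ card ?A) =
          fact (card ?A) * (\<Prod>i\<in>?A. \<xi> i \<omega>)" .
    qed
    finally show ?thesis unfolding n by (simp add: mult_ac)
  qed
  have "fact ?n * expectation (\<lambda>\<omega>. \<xi> x \<omega> * (\<Prod>i\<in>A. \<xi> i \<omega>)) =
      expectation (\<lambda>\<omega>. \<xi> x \<omega> * (fact ?n * (\<Prod>i\<in>A. \<xi> i \<omega>)))"
    by (simp add: mult.left_commute)
  also have "\<dots> = (\<Sum>B\<in>Pow A. (- 1) ^ card (A - B) * expectation (\<lambda>\<omega>. \<xi> x \<omega> * ?S B \<omega> ^ ?n))"
    unfolding pol sum_distrib_left mult.left_commute[of "\<xi> x _"]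
    by (subst Bochner_Integration.integral_sum) (intro integrable_mult_right int_mult, simp_all)
  also have "\<dots> = (\<Sum>B\<in>Pow A. expectation (\<xi> x) * ((- 1) ^ card (A - B) * expectation (\<lambda>\<omega>. ?S B \<omega> ^ ?n))) +
      (\<Sum>B\<in>Pow A. \<Sum>y\<in>B. ?C y * ((- 1) ^ card (A - B) * (real ?n * expectation (\<lambda>\<omega>. ?S B \<omega> ^ (?n - 1)))))"
    unfolding sum.distrib[symmetric]
    by (intro sum.cong refl, subst parts) (simp_all add: distrib_left sum_distrib_left mult_ac)
  also have "(\<Sum>B\<in>Pow A. expectation (\<xi> x) * ((- 1) ^ card (A - B) * expectation (\<lambda>\<omega>. ?S B \<omega> ^ ?n))) =
      expectation (\<xi> x) * (fact ?n * expectation (\<lambda>\<omega>. \<Prod>i\<in>A. \<xi> i \<omega>))"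
  proof -
    have "fact ?n * expectation (\<lambda>\<omega>. \<Prod>i\<in>A. \<xi> i \<omega>) = expectation (\<lambda>\<omega>. fact ?n * (\<Prod>i\<in>A. \<xi> i \<omega>))"
      by simp
    also have "\<dots> = (\<Sum>B\<in>Pow A. (- 1) ^ card (A - B) * expectation (\<lambda>\<omega>. ?S B \<omega> ^ ?n))"
      unfolding pol
      by (subst Bochner_Integration.integral_sum) (intro integrable_mult_right int_pow, simp_all)
    finally show ?thesis by (simp add: sum_distrib_left)
  qed
  also have "(\<Sum>B\<in>Pow A. \<Sum>y\<in>B. ?C y * ((- 1) ^ card (A - B) * (real ?n * expectation (\<lambda>\<omega>. ?S B \<omega> ^ (?n - 1))))) =
      (\<Sum>B\<in>Pow A. \<Sum>y\<in>{y \<in> A. y \<in> B}. ?C y * ((- 1) ^ card (A - B) * (real ?n * expectation (\<lambda>\<omega>. ?S B \<omega> ^ (?n - 1)))))"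
    by (intro sum.cong refl) auto
  also have "\<dots> = (\<Sum>y\<in>A. \<Sum>B\<in>{B \<in> Pow A. y \<in> B}. ?C y * ((- 1) ^ card (A - B) *
      (real ?n * expectation (\<lambda>\<omega>. ?S B \<omega> ^ (?n - 1)))))"
    using fin by (intro sum.swap_restrict) auto
  also have "\<dots> = (\<Sum>y\<in>A. ?C y * (fact ?n * expectation (\<lambda>\<omega>. \<Prod>i\<in>A - {y}. \<xi> i \<omega>)))"
    unfolding sum_distrib_left[symmetric] by (intro sum.cong refl) (simp only: removed)
  also have "expectation (\<xi> x) * (fact ?n * expectation (\<lambda>\<omega>. \<Prod>i\<in>A. \<xi> i \<omega>)) + \<dots> =
      fact ?n * (expectation (\<xi> x) * expectation (\<lambda>\<omega>. \<Prod>i\<in>A. \<xi> i \<omega>) +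
        (\<Sum>y\<in>A. ?C y * expectation (\<lambda>\<omega>. \<Prod>i\<in>A - {y}. \<xi> i \<omega>)))"
    by (simp add: distrib_left sum_distrib_left mult_ac)
  finally show ?thesis by (simp only: mult_cancel_left) simp
qed

section \<open>The recursion for configurations\<close>

lemma configuration_block_subset:
  "\<omega> \<in> configurations A \<Longrightarrow> B \<in> \<omega> \<Longrightarrow> B \<subseteq> A"
  by (auto simp: configurations_def partition_on_def)

lemma finite_configurations:
  assumes "finite A"
  shows "finite (configurations A)"
  by (rule finite_subset[of _ "Pow (Pow A)"])
     (use assms configuration_block_subset in \<open>auto\<close>)

lemma finite_configuration:
  assumes "finite A" "\<omega> \<in> configurations A"
  shows "finite \<omega>"
  by (rule finite_subset[of _ "Pow A"])
     (use assms configuration_block_subset in \<open>auto\<close>)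

lemma insert_block_configuration:
  assumes "\<omega> \<in> configurations A" "B \<inter> A = {}" "card B = 1 \<or> card B = 2"
  shows "insert B \<omega> \<in> configurations (B \<union> A)"
proof -
  have "disjnt B (\<Union>\<omega>)" and "(B \<union> A) - B = A" and "B \<noteq> {}"
    using assms by (auto simp: configurations_def partition_on_def disjnt_def)
  then show ?thesis
    using assms by (auto simp: configurations_def partition_on_insert)
qed

lemma remove_block_configuration:
  assumes "\<omega> \<in> configurations A" "B \<in> \<omega>"
  shows "\<omega> - {B} \<in> configurations (A - B)"
proof -
  have "disjnt B (\<Union>(\<omega> - {B}))"
    using assms by (auto simp: configurations_def partition_on_def disjnt_def disjoint_def)
  then have "partition_on (A - B) (\<omega> - {B})"
    using assms partition_on_insert[of B "\<omega> - {B}" A]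
    by (auto simp: configurations_def insert_absorb)
  then show ?thesis using assms by (auto simp: configurations_def)
qed

text \<open>
  The block of \<open>x\<close> is either \<open>{x}\<close> or \<open>{x, y}\<close>, and removing it leaves a configuration of the
  remaining sites.
\<close>

lemma configurations_insert:
  assumes x: "x \<notin> A"
  shows "configurations (insert x A) =
    insert {x} ` configurations A \<union> (\<Union>y\<in>A. insert {x, y} ` configurations (A - {y}))"
proof (intro equalityI subsetI)
  fix \<omega> assume \<omega>: "\<omega> \<in> configurations (insert x A)"
  then obtain B where B: "B \<in> \<omega>" "x \<in> B"
    by (auto simp: configurations_def partition_on_def)
  have \<omega>_eq: "insert B (\<omega> - {B}) = \<omega>" using B by auto
  have rest: "\<omega> - {B} \<in> configurations (insert x A - B)"
    by (rule remove_block_configuration[OF \<omega> B(1)])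
  from \<omega> B consider "card B = 1" | "card B = 2" by (auto simp: configurations_def)
  then show "\<omega> \<in> insert {x} ` configurations A \<union> (\<Union>y\<in>A. insert {x, y} ` configurations (A - {y}))"
  proof cases
    case 1
    then have "B = {x}" using B by (auto simp: card_1_singleton_iff)
    then have "insert B (\<omega> - {B}) \<in> insert {x} ` configurations A"
      using rest x by (metis Diff_insert_absorb imageI)
    then show ?thesis unfolding \<omega>_eq by blast
  next
    case 2
    then obtain y where y: "B = {x, y}" "y \<noteq> x"
      using B by (auto simp: card_2_iff)
    then have "y \<in> A" using configuration_block_subset[OF \<omega> B(1)] by auto
    moreover have "insert x A - B = A - {y}" using y x by auto
    then have "insert B (\<omega> - {B}) \<in> insert {x, y} ` configurations (A - {y})"
      using rest y by (metis imageI)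
    ultimately show ?thesis unfolding \<omega>_eq by blast
  qed
next
  fix \<omega> assume "\<omega> \<in> insert {x} ` configurations A \<union> (\<Union>y\<in>A. insert {x, y} ` configurations (A - {y}))"
  then consider \<tau> where "\<tau> \<in> configurations A" "\<omega> = insert {x} \<tau>"
    | y \<tau> where "y \<in> A" "\<tau> \<in> configurations (A - {y})" "\<omega> = insert {x, y} \<tau>"
    by auto
  then show "\<omega> \<in> configurations (insert x A)"
  proof cases
    case 1
    then show ?thesis using insert_block_configuration[of \<tau> A "{x}"] x by simp
  next
    case 2
    then have "{x, y} \<union> (A - {y}) = insert x A" "x \<noteq> y" using x by auto
    then show ?thesis
      using insert_block_configuration[of \<tau> "A - {y}" "{x, y}"] x 2 by simp
  qed
qed

text \<open>
  The block of \<open>x\<close> can be read off from the configuration, so the pieces of the decomposition are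
  disjoint and each of them is in bijection with the configurations of the smaller set.
\<close>

lemma sum_configurations_insert:
  fixes w :: "'s set \<Rightarrow> 'b::comm_semiring_1"
  assumes fin: "finite A" and x: "x \<notin> A"
  shows "(\<Sum>\<omega>\<in>configurations (insert x A). \<Prod>B\<in>\<omega>. w B) =
    w {x} * (\<Sum>\<omega>\<in>configurations A. \<Prod>B\<in>\<omega>. w B) +
    (\<Sum>y\<in>A. w {x, y} * (\<Sum>\<omega>\<in>configurations (A - {y}). \<Prod>B\<in>\<omega>. w B))"
proof -
  have fresh: "B \<notin> \<omega>" if "\<omega> \<in> configurations A'" "A' \<subseteq> A" "x \<in> B" for B \<omega> A'
    using configuration_block_subset[OF that(1), of B] that x by auto
  have block: "(\<Sum>\<omega>\<in>insert B ` configurations A'. \<Prod>B\<in>\<omega>. w B) =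
      w B * (\<Sum>\<omega>\<in>configurations A'. \<Prod>B\<in>\<omega>. w B)" if "A' \<subseteq> A" "x \<in> B" for A' B
  proof -
    have "inj_on (insert B) (configurations A')"
      using fresh[OF _ that] by (intro inj_onI) (metis insert_ident)
    moreover have "finite A'" using that(1) fin by (rule finite_subset)
    ultimately show ?thesis
      by (simp add: sum.reindex sum_distrib_left fresh[OF _ that] finite_configuration)
  qed
  have fin_im: "finite (insert B ` configurations A')" if "A' \<subseteq> A" for A' B
    using that fin by (intro finite_imageI finite_configurations) (rule finite_subset)
  have disj: "insert B ` configurations A' \<inter> insert C ` configurations A'' = {}"
    if "A' \<subseteq> A" "A'' \<subseteq> A" "x \<in> B" "x \<in> C" "B \<noteq> C" for A' A'' B C
    using fresh[OF _ that(1) that(4)] that(5) by blast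
  have "(\<Sum>\<omega>\<in>configurations (insert x A). \<Prod>B\<in>\<omega>. w B) =
      (\<Sum>\<omega>\<in>insert {x} ` configurations A. \<Prod>B\<in>\<omega>. w B) +
      (\<Sum>\<omega>\<in>(\<Union>y\<in>A. insert {x, y} ` configurations (A - {y})). \<Prod>B\<in>\<omega>. w B)"
    unfolding configurations_insert[OF x]
  proof (rule sum.union_disjoint)
    have "insert {x} ` configurations A \<inter> insert {x, y} ` configurations (A - {y}) = {}" if "y \<in> A" for y
      using that x by (intro disj) auto
    then show "insert {x} ` configurations A \<inter> (\<Union>y\<in>A. insert {x, y} ` configurations (A - {y})) = {}"
      by blast
  qed (use fin in \<open>auto intro!: fin_im\<close>)
  also have "(\<Sum>\<omega>\<in>(\<Union>y\<in>A. insert {x, y} ` configurations (A - {y})). \<Prod>B\<in>\<omega>. w B) =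
      (\<Sum>y\<in>A. \<Sum>\<omega>\<in>insert {x, y} ` configurations (A - {y}). \<Prod>B\<in>\<omega>. w B)"
  proof (rule sum.UNION_disjoint[OF fin])
    show "\<forall>y\<in>A. \<forall>z\<in>A. y \<noteq> z \<longrightarrow>
        insert {x, y} ` configurations (A - {y}) \<inter> insert {x, z} ` configurations (A - {z}) = {}"
      using x by (intro ballI impI disj) (auto simp: doubleton_eq_iff)
  qed (auto intro!: fin_im)
  finally show ?thesis by (simp add: block)
qed

section \<open>Isserlis' theorem\<close>

text \<open>
  Formulating the weights as an arbitrary function on blocks, constrained on singletons and pairs
  only, allows an immediate comparison with Boltzmann weights and avoids choosing representatives
  of an unordered pair.
\<close>

theorem (in prob_space) isserlis:
  assumes G: "gaussian_field M \<xi>" and "finite A"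
    and mean: "\<And>x. x \<in> A \<Longrightarrow> w {x} = expectation (\<xi> x)"
    and cov: "\<And>x y. x \<in> A \<Longrightarrow> y \<in> A \<Longrightarrow> x \<noteq> y \<Longrightarrow> w {x, y} = covariance M (\<xi> x) (\<xi> y)"
  shows "expectation (\<lambda>\<omega>. \<Prod>x\<in>A. \<xi> x \<omega>) = (\<Sum>\<omega>\<in>configurations A. \<Prod>B\<in>\<omega>. w B)"
  using assms(2-)
proof (induction A rule: finite_psubset_induct)
  case (psubset A)
  show ?case
  proof (cases "A = {}")
    case True
    have "configurations {} = {{} :: 'b set set}"
      by (auto simp: configurations_def partition_on_empty)
    then show ?thesis using True by (simp add: prob_space)
  next
    case False
    then obtain x where "x \<in> A" by blast
    then obtain A' where A: "A = insert x A'" "x \<notin> A'" by (rule mk_disjoint_insert[THEN exE]) blast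
    have fin: "finite A'" using psubset.hyps A by simp
    have IH: "expectation (\<lambda>\<omega>. \<Prod>x\<in>A''. \<xi> x \<omega>) = (\<Sum>\<omega>\<in>configurations A''. \<Prod>B\<in>\<omega>. w B)"
      if "A'' \<subseteq> A'" for A''
      using that A by (intro psubset.IH psubset.prems) auto
    have "expectation (\<lambda>\<omega>. \<Prod>x\<in>A. \<xi> x \<omega>) = expectation (\<lambda>\<omega>. \<xi> x \<omega> * (\<Prod>i\<in>A'. \<xi> i \<omega>))"
      using A fin by simp
    also have "\<dots> = w {x} * (\<Sum>\<omega>\<in>configurations A'. \<Prod>B\<in>\<omega>. w B) +
        (\<Sum>y\<in>A'. w {x, y} * (\<Sum>\<omega>\<in>configurations (A' - {y}). \<Prod>B\<in>\<omega>. w B))"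
    proof -
      have "w {x, y} = covariance M (\<xi> x) (\<xi> y)" if "y \<in> A'" for y
        using that A by (intro psubset.prems(2)) auto
      then show ?thesis
        unfolding gaussian_integration_by_parts_prod[OF G fin]
        using psubset.prems(1)[of x] A by (simp add: IH)
    qed
    also have "\<dots> = (\<Sum>\<omega>\<in>configurations A. \<Prod>B\<in>\<omega>. w B)"
      unfolding A(1) by (rule sum_configurations_insert[OF fin A(2), symmetric])
    finally show ?thesis .
  qed
qed

section \<open>Boltzmann weights of configurations\<close>

lemma boltzmann_0 [simp]: "boltzmann \<beta> 0 = 1"
  by (simp add: boltzmann_def)

lemma boltzmann_add:
  assumes "a \<noteq> -\<infinity>" "b \<noteq> -\<infinity>"
  shows "boltzmann \<beta> (a + b) = boltzmann \<beta> a * boltzmann \<beta> b"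
  using assms by (cases a; cases b) (auto simp: boltzmann_def algebra_simps exp_add[symmetric])

lemma sum_ereal_neq_MInfty:
  fixes e :: "'i \<Rightarrow> ereal"
  assumes "\<And>i. i \<in> I \<Longrightarrow> e i \<noteq> -\<infinity>"
  shows "(\<Sum>i\<in>I. e i) \<noteq> -\<infinity>"
  using assms
  by (induction I rule: infinite_finite_induct) auto

lemma boltzmann_sum:
  assumes "\<And>i. i \<in> I \<Longrightarrow> e i \<noteq> -\<infinity>"
  shows "boltzmann \<beta> (\<Sum>i\<in>I. e i) = (\<Prod>i\<in>I. boltzmann \<beta> (e i))"
  using assms
proof (induction I rule: infinite_finite_induct)
  case (insert i I)
  then have "(\<Sum>i\<in>I. e i) \<noteq> -\<infinity>" by (intro sum_ereal_neq_MInfty) auto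
  then show ?case using insert by (simp add: boltzmann_add)
qed simp_all

text \<open>
  The case \<open>V = \<infinity>\<close> is consistent: without monomers, \<open>0 \<cdot> \<infinity> = 0\<close> and the empty power of the
  zero weight both give 1, and with monomers both sides vanish.
\<close>

lemma boltzmann_multiple:
  assumes "V \<noteq> -\<infinity>"
  shows "boltzmann \<beta> (ereal (real k) * V) = boltzmann \<beta> V ^ k"
  using assms by (cases V) (auto simp: boltzmann_def exp_of_nat_mult[symmetric] mult_ac power_0_left)

lemma dimer_energy_pair:
  assumes "\<And>z. W (- z) = W z"
  shows "dimer_energy W {x, y} = W (x - y)"
  unfolding dimer_energy_def
proof (rule the_equality)
  fix e assume "\<exists>u v. {x, y} = {u, v} \<and> e = W (u - v)"
  then show "e = W (x - y)"
    using assms[of "x - y"] by (auto simp: doubleton_eq_iff)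
qed blast

text \<open>
  The blocks have total size \<open>card A\<close>; in particular the subtraction is not truncated.
\<close>

lemma card_monomers:
  assumes "finite A" "\<omega> \<in> configurations A"
  shows "card (\<omega> - dimers \<omega>) = card A - 2 * card (dimers \<omega>)"
proof -
  note fin = finite_configuration[OF assms]
  have d: "dimers \<omega> \<subseteq> \<omega>" by (auto simp: dimers_def)
  have "card A = (\<Sum>B\<in>\<omega>. card B)"
  proof (rule product_partition)
    show "partition_on A \<omega>" using assms(2) by (simp add: configurations_def)
    show "finite B" if "B \<in> \<omega>" for B
      using configuration_block_subset[OF assms(2) that] assms(1) by (rule finite_subset)
  qed
  also have "\<dots> = (\<Sum>B\<in>\<omega> - dimers \<omega>. card B) + (\<Sum>B\<in>dimers \<omega>. card B)"
    by (rule sum.subset_diff[OF d fin])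
  also have "(\<Sum>B\<in>\<omega> - dimers \<omega>. card B) = (\<Sum>B\<in>\<omega> - dimers \<omega>. 1)"
    using assms by (intro sum.cong) (auto simp: configurations_def dimers_def)
  also have "(\<Sum>B\<in>dimers \<omega>. card B) = (\<Sum>B\<in>dimers \<omega>. 2)"
    by (intro sum.cong) (auto simp: dimers_def)
  finally show ?thesis by simp
qed

definition block_weight :: "real \<Rightarrow> ereal \<Rightarrow> ('s::ab_group_add \<Rightarrow> ereal) \<Rightarrow> 's set \<Rightarrow> real" where
  "block_weight \<beta> V W B = boltzmann \<beta> (if card B = 2 then dimer_energy W B else V)"

lemma boltzmann_config_energy:
  assumes "finite A" and \<omega>: "\<omega> \<in> configurations A"
    and V: "V \<noteq> -\<infinity>" and W: "\<And>z. W z \<noteq> -\<infinity>" and even: "\<And>z. W (- z) = W z"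
  shows "boltzmann \<beta> (config_energy V W A \<omega>) = (\<Prod>B\<in>\<omega>. block_weight \<beta> V W B)"
proof -
  note fin = finite_configuration[OF assms(1,2)]
  have d: "dimers \<omega> \<subseteq> \<omega>" by (auto simp: dimers_def)
  have dimer: "dimer_energy W B \<noteq> -\<infinity>" if "B \<in> dimers \<omega>" for B
    using that W by (auto simp: dimers_def card_2_iff dimer_energy_pair[of W, OF even])
  have monomer: "ereal (real (card (\<omega> - dimers \<omega>))) * V \<noteq> -\<infinity>"
    using V by (cases V) auto
  have "boltzmann \<beta> (config_energy V W A \<omega>) =
      boltzmann \<beta> V ^ card (\<omega> - dimers \<omega>) * (\<Prod>B\<in>dimers \<omega>. boltzmann \<beta> (dimer_energy W B))"
    unfolding config_energy_def card_monomers[OF assms(1,2), symmetric]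
    using dimer monomer
    by (subst boltzmann_add) (auto simp: sum_ereal_neq_MInfty boltzmann_sum boltzmann_multiple[OF V])
  also have "\<dots> = (\<Prod>B\<in>\<omega> - dimers \<omega>. block_weight \<beta> V W B) * (\<Prod>B\<in>dimers \<omega>. block_weight \<beta> V W B)"
  proof -
    have "(\<Prod>B\<in>\<omega> - dimers \<omega>. block_weight \<beta> V W B) = (\<Prod>B\<in>\<omega> - dimers \<omega>. boltzmann \<beta> V)"
      by (intro prod.cong) (auto simp: block_weight_def dimers_def)
    moreover have "(\<Prod>B\<in>dimers \<omega>. block_weight \<beta> V W B) = (\<Prod>B\<in>dimers \<omega>. boltzmann \<beta> (dimer_energy W B))"
      by (intro prod.cong) (auto simp: block_weight_def dimers_def)
    ultimately show ?thesis by simp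
  qed
  also have "\<dots> = (\<Prod>B\<in>\<omega>. block_weight \<beta> V W B)"
    by (rule prod.subset_diff[OF d fin, symmetric])
  finally show ?thesis .
qed

theorem theorem3p1:
  fixes T \<beta> :: real
    and V :: ereal
    and W :: "int ^ 'n::finite \<Rightarrow> ereal"
    and M :: "'a measure"
    and \<xi> :: "int ^ 'n \<Rightarrow> 'a \<Rightarrow> real"
    and \<Lambda> :: "(int ^ 'n) set"
  assumes "T > 0" and "\<beta> = 1 / T"
    and "V \<noteq> -\<infinity>"
    and "\<And>z. W z \<noteq> -\<infinity>"
    and "\<And>z. W (- z) = W z"
    and "W 0 \<noteq> \<infinity>"
    and "(\<lambda>z. boltzmann \<beta> (W z)) summable_on (UNIV - {0})"
    and "boltzmann \<beta> (W 0) \<ge> (\<Sum>\<^sub>\<infinity>z\<in>UNIV - {0}. boltzmann \<beta> (W z))"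
    and "prob_space M"
    and "gaussian_field M \<xi>"
    and "homogeneous_field M \<xi>"
    and "\<And>x. prob_space.expectation M (\<xi> x) = boltzmann \<beta> V"
    and "\<And>x y. covariance M (\<xi> x) (\<xi> y) = boltzmann \<beta> (W (x - y))"
    and "finite \<Lambda>" and "\<Lambda> \<noteq> {}"
  shows "integrable M (\<lambda>\<omega>. \<Prod>x\<in>\<Lambda>. \<xi> x \<omega>) \<and>
    partition_function \<beta> V W \<Lambda> = prob_space.expectation M (\<lambda>\<omega>. \<Prod>x\<in>\<Lambda>. \<xi> x \<omega>)"
proof
  interpret prob_space M by fact
  show "integrable M (\<lambda>\<omega>. \<Prod>x\<in>\<Lambda>. \<xi> x \<omega>)"
    by (rule gaussian_field_integrable_prod) fact+
  have "partition_function \<beta> V W \<Lambda> = (\<Sum>\<omega>\<in>configurations \<Lambda>. \<Prod>B\<in>\<omega>. block_weight \<beta> V W B)"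
    unfolding partition_function_def
    by (intro sum.cong refl boltzmann_config_energy) (use assms in auto)
  also have "\<dots> = expectation (\<lambda>\<omega>. \<Prod>x\<in>\<Lambda>. \<xi> x \<omega>)"
    by (rule isserlis[symmetric])
       (use assms in \<open>auto simp: block_weight_def dimer_energy_pair\<close>)
  finally show "partition_function \<beta> V W \<Lambda> = expectation (\<lambda>\<omega>. \<Prod>x\<in>\<Lambda>. \<xi> x \<omega>)" .
qed

end
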